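(* Let $T$ be a tournament with at least five vertices that is $\Delta(1,2,2)$-free, $T_5$-free and $P_7^-$-free. Suppose there is a vertex $x\in V(T)$ such that $T\setminus x$ is a paving tournament and $x$ has at least two in-neighbours and at least two out-neighbours. Then $T$ is a paving tournament.
   Context: Tournaments are finite; $T\setminus x$ is $T$ with $x$ deleted; $T$ is $S$-free if no induced subtournament is isomorphic to $S$; $X\Rightarrow Y$ means all edges between disjoint $X,Y$ go from $X$ to $Y$. $\Delta(1,2,2)$: vertices $x,y_1,y_2,z_1,z_2$ with $x\Rightarrow\{y_1,y_2\}\Rightarrow\{z_1,z_2\}\Rightarrow x$ and edges $y_1y_2,z_1z_2$. $T_5$: vertices $v_1,\dots,v_5$, $v_iv_j\in E$ iff $j-i\equiv1,2\pmod5$. $P_7^-$: obtained by deleting one vertex from $P_7$, the tournament on $v_1,\dots,v_7$ with $v_iv_j\in E$ iff $j-i\equiv1,2,4\pmod7$. For an ordering $\sigma=(v_1,\dots,v_n)$, the backedge graph $B_\sigma(T)$ is the undirected graph on $V(T)$ with edges $v_iv_j$ for $i>j$ and $v_iv_j\in E(T)$. $T$ is a paving tournament if some ordering $\sigma=(v_1,\dots,v_n)$ satisfies: $v_i,v_{i+1}$ are nonadjacent in $B_\sigma(T)$ for each $i\in[n-1]$, and each $v_i$ has at most one $B_\sigma(T)$-neighbour in $\{v_s:s<i\}$ and at most one in $\{v_t:t>i\}$. *)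

theory Defs
  imports "Graph_Theory.Graph_Theory"
begin

text \<open>
  The locale \<^locale>\<open>digraph\<close> already provides finiteness and the absence of loops and of parallel
  arcs; \<open>u \<rightarrow>\<^bsub>T\<^esub> v\<close> is the library's notation for an arc from \<open>u\<close> to \<open>v\<close>.
\<close>

locale tournament = digraph T for T :: "('a, 'b) pre_digraph" +
  assumes exactly_one_arc:
    "\<lbrakk>u \<in> verts T; v \<in> verts T; u \<noteq> v\<rbrakk> \<Longrightarrow> (u \<rightarrow>\<^bsub>T\<^esub> v) \<longleftrightarrow> \<not> (v \<rightarrow>\<^bsub>T\<^esub> u)"

definition free_of :: "('c, 'd) pre_digraph \<Rightarrow> ('a, 'b) pre_digraph \<Rightarrow> bool" where
  "free_of S T \<longleftrightarrow> \<not> (\<exists>H. induced_subgraph H T \<and> digraph_iso H S)"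

text \<open>The vertices \<open>x, y\<^sub>1, y\<^sub>2, z\<^sub>1, z\<^sub>2\<close> of \<open>\<Delta>(1,2,2)\<close> are numbered \<open>0, 1, 2, 3, 4\<close>.\<close>

definition Delta_1_2_2 :: "(nat, nat \<times> nat) pre_digraph" where
  "Delta_1_2_2 = with_proj \<lparr> pverts = {0, 1, 2, 3, 4},
     parcs = {0} \<times> {1, 2} \<union> {1, 2} \<times> {3, 4} \<union> {3, 4} \<times> {0} \<union> {(1, 2), (3, 4)} \<rparr>"

definition T5 :: "(int, int \<times> int) pre_digraph" where
  "T5 = with_proj \<lparr> pverts = {1..5},
     parcs = {(i, j). i \<in> {1..5} \<and> j \<in> {1..5} \<and> (j - i) mod 5 \<in> {1, 2}} \<rparr>"

definition P7 :: "(int, int \<times> int) pre_digraph" where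
  "P7 = with_proj \<lparr> pverts = {1..7},
     parcs = {(i, j). i \<in> {1..7} \<and> j \<in> {1..7} \<and> (j - i) mod 7 \<in> {1, 2, 4}} \<rparr>"

text \<open>
  Rotation acts transitively on the vertices of \<^const>\<open>P7\<close>, so up to isomorphism it does not matter
  which vertex is deleted.
\<close>

definition P7_minus :: "(int, int \<times> int) pre_digraph" where
  "P7_minus = pre_digraph.del_vert P7 7"

text \<open>
  An ordering of the vertices of \<open>T\<close> is a duplicate-free list enumerating them, with indices
  starting at \<open>0\<close>. As usual in this library, an undirected graph is a symmetric digraph
  (\<^locale>\<open>pair_graph\<close>), each edge being represented by both of its orientations.
\<close>

definition vertex_ordering :: "('a, 'b) pre_digraph \<Rightarrow> 'a list \<Rightarrow> bool" where
  "vertex_ordering T vs \<longleftrightarrow> distinct vs \<and> set vs = verts T"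

definition backedge_graph :: "('a, 'b) pre_digraph \<Rightarrow> 'a list \<Rightarrow> 'a pair_pre_digraph" where
  "backedge_graph T vs = \<lparr> pverts = verts T,
     parcs = (\<Union>(i, j) \<in> {(i, j). j < i \<and> i < length vs \<and> vs ! i \<rightarrow>\<^bsub>T\<^esub> vs ! j}.
       {(vs ! i, vs ! j), (vs ! j, vs ! i)}) \<rparr>"

definition paving_ordering :: "('a, 'b) pre_digraph \<Rightarrow> 'a list \<Rightarrow> bool" where
  "paving_ordering T vs \<longleftrightarrow> vertex_ordering T vs \<and>
     (\<forall>i. Suc i < length vs \<longrightarrow> \<not> (vs ! i \<rightarrow>\<^bsub>backedge_graph T vs\<^esub> vs ! Suc i)) \<and>
     (\<forall>i < length vs.
        card {vs ! s | s. s < i \<and> vs ! i \<rightarrow>\<^bsub>backedge_graph T vs\<^esub> vs ! s} \<le> 1 \<and>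
        card {vs ! t | t. i < t \<and> t < length vs \<and> vs ! i \<rightarrow>\<^bsub>backedge_graph T vs\<^esub> vs ! t} \<le> 1)"

definition paving_tournament :: "('a, 'b) pre_digraph \<Rightarrow> bool" where
  "paving_tournament T \<longleftrightarrow> tournament T \<and> (\<exists>vs. paving_ordering T vs)"

end

theory Submission
  imports Defs
begin

text \<open>
  A tournament omitting the three patterns is paving, by induction on the number of vertices. It
  suffices to order the vertices so that every vertex has at most one backedge on either side: such
  an order with the fewest backedges has no consecutive backedge.

  Some vertex has in-degree at most \<open>1\<close>. Otherwise, for every \<open>y\<close>, the first vertex of an ordering
  of \<open>T \ y\<close> has in-degree \<open>2\<close> and \<open>y\<close> as an in-neighbour; so the vertices of in-degree \<open>2\<close> contain
  a cyclic triangle, and this triangle with its further in-neighbours yields a forbidden pattern.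

  A vertex \<open>x\<close> of in-degree at most \<open>1\<close> is put in front of an ordering of \<open>T \ x\<close>. This fails only
  if its in-neighbour \<open>k\<close> already has a backedge to some earlier \<open>j\<close>. As \<open>\<Delta>(1,2,2)\<close> is omitted,
  exactly one vertex \<open>m\<close> lies between \<open>j\<close> and \<open>k\<close>, and rotating the cyclic triangle \<open>j, m, k\<close> to
  \<open>m, k, j\<close> or to \<open>k, j, m\<close> repairs the ordering.
\<close>

section \<open>Rankings with sparse backedges\<close>

text \<open>Ranks are arbitrary integers, not positions: once doubling has freed the odd numbers, a
  vertex is inserted or moved by changing one value. The condition on consecutive vertices is left
  out here and restored by \<open>sparse_ranking_no_consecutive\<close>.\<close>

definition sparse_ranking :: "'a set \<Rightarrow> ('a \<Rightarrow> 'a \<Rightarrow> bool) \<Rightarrow> ('a \<Rightarrow> int) \<Rightarrow> bool" where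
  "sparse_ranking V A r \<longleftrightarrow> inj_on r V \<and>
     (\<forall>u\<in>V. \<forall>v\<in>V. \<forall>w\<in>V. r u < r v \<and> A v u \<and> r u < r w \<and> A w u \<longrightarrow> v = w) \<and>
     (\<forall>u\<in>V. \<forall>v\<in>V. \<forall>w\<in>V. r v < r u \<and> A u v \<and> r w < r u \<and> A u w \<longrightarrow> v = w)"

text \<open>\<open>B\<close> may be any relation containing the backedges, since being functional in
  both directions passes to subrelations.\<close>

lemma sparse_rankingI:
  assumes "inj_on r V"
    and "\<And>u v. \<lbrakk>u \<in> V; v \<in> V; r u < r v; A v u\<rbrakk> \<Longrightarrow> B u v"
    and "\<And>u v w. \<lbrakk>B u v; B u w\<rbrakk> \<Longrightarrow> v = w"
    and "\<And>u v w. \<lbrakk>B v u; B w u\<rbrakk> \<Longrightarrow> v = w"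
  shows "sparse_ranking V A r"
  unfolding sparse_ranking_def using assms by meson

lemma sparse_ranking_inj: "\<lbrakk>sparse_ranking V A r; u \<in> V; v \<in> V; r u = r v\<rbrakk> \<Longrightarrow> u = v"
  by (auto simp: sparse_ranking_def dest: inj_onD)

lemma sparse_ranking_later:
  "\<lbrakk>sparse_ranking V A r; u \<in> V; v \<in> V; w \<in> V; r u < r v; A v u; r u < r w; A w u\<rbrakk> \<Longrightarrow> v = w"
  unfolding sparse_ranking_def by blast

lemma sparse_ranking_earlier:
  "\<lbrakk>sparse_ranking V A r; u \<in> V; v \<in> V; w \<in> V; r v < r u; A u v; r w < r u; A u w\<rbrakk> \<Longrightarrow> v = w"
  unfolding sparse_ranking_def by blast

section \<open>Tournament relations and the removal of consecutive backedges\<close>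

locale arc_relation =
  fixes V :: "'a set" and A :: "'a \<Rightarrow> 'a \<Rightarrow> bool"
  assumes finite_verts: "finite V"
    and irrefl: "v \<in> V \<Longrightarrow> \<not> A v v"
    and total: "\<lbrakk>u \<in> V; v \<in> V; u \<noteq> v\<rbrakk> \<Longrightarrow> A u v \<longleftrightarrow> \<not> A v u"
begin

text \<open>Swapping the ends of a consecutive backedge destroys it and creates no other backedge.\<close>

lemma sparse_ranking_no_consecutive:
  assumes "sparse_ranking V A r"
  shows "\<exists>r. sparse_ranking V A r \<and>
    (\<forall>u\<in>V. \<forall>v\<in>V. r u < r v \<and> A v u \<longrightarrow> (\<exists>w\<in>V. r u < r w \<and> r w < r v))"
proof -
  define bk where "bk r = {(u, v) \<in> V \<times> V. r u < r v \<and> A v u}" for r :: "'a \<Rightarrow> int"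
  have fin: "finite (bk r)" for r
    by (rule finite_subset[of _ "V \<times> V"]) (auto simp: bk_def finite_verts)
  from assms show ?thesis
  proof (induction "card (bk r)" arbitrary: r rule: less_induct)
    case less
    note sp = less.prems
    show ?case
    proof (cases "\<forall>u\<in>V. \<forall>v\<in>V. r u < r v \<and> A v u \<longrightarrow> (\<exists>w\<in>V. r u < r w \<and> r w < r v)")
      case True
      with sp show ?thesis by blast
    next
      case False
      then obtain u v where uv: "u \<in> V" "v \<in> V" "r u < r v" "A v u"
        and gap: "\<And>w. w \<in> V \<Longrightarrow> \<not> (r u < r w \<and> r w < r v)" by blast
      then have "\<not> A u v" using total by blast
      define r' where "r' = r(u := r v, v := r u)"
      note inj = sparse_ranking_inj[OF sp]
      \<comment> \<open>No rank lies strictly between those of \<open>u\<close> and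
        \<open>v\<close>, so the swap reverses the comparison of these two vertices and no
        other.\<close>
      have sub: "r p < r q \<and> (p, q) \<noteq> (u, v)"
        if "p \<in> V" "q \<in> V" "r' p < r' q" "(p, q) \<noteq> (v, u)" for p q
        using that uv gap[of p] gap[of q] inj[of p u] inj[of p v] inj[of q u] inj[of q v]
        by (auto simp: r'_def split: if_splits) (metis linorder_cases)+
      then have bk: "bk r' \<subseteq> bk r - {(u, v)}"
        using \<open>\<not> A u v\<close> by (auto simp: bk_def)
      have "sparse_ranking V A r'"
      proof (rule sparse_rankingI[where B = "\<lambda>p q. (p, q) \<in> bk r"])
        show "inj_on r' V"
          using inj uv by (auto simp: inj_on_def r'_def)
      qed (use bk sp in \<open>auto simp: bk_def dest: sparse_ranking_later sparse_ranking_earlier\<close>)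
      moreover have "card (bk r') < card (bk r)"
        by (rule psubset_card_mono[OF fin]) (use bk uv in \<open>auto simp: bk_def\<close>)
      ultimately show ?thesis using less.hyps by blast
    qed
  qed
qed

end

text \<open>Listing the arcs suffices: any two vertices of a pattern are joined by a listed arc, so
  \<open>irrefl\<close> makes them distinct and \<open>total\<close> makes the copy induced.\<close>

locale pattern_free = arc_relation +
  assumes no_Delta: "\<lbrakk>{x, y1, y2, z1, z2} \<subseteq> V; A x y1; A x y2; A y1 z1; A y1 z2; A y2 z1; A y2 z2;
      A z1 x; A z2 x; A y1 y2; A z1 z2\<rbrakk> \<Longrightarrow> False"
    and no_T5: "\<lbrakk>{v1, v2, v3, v4, v5} \<subseteq> V; A v1 v2; A v1 v3; A v2 v3; A v2 v4; A v3 v4; A v3 v5;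
      A v4 v5; A v4 v1; A v5 v1; A v5 v2\<rbrakk> \<Longrightarrow> False"
    and no_P7_minus: "\<lbrakk>{v1, v2, v3, v4, v5, v6} \<subseteq> V; A v1 v2; A v1 v3; A v1 v5; A v2 v3; A v2 v4;
      A v2 v6; A v3 v4; A v3 v5; A v4 v5; A v4 v6; A v4 v1; A v5 v6; A v5 v2; A v6 v1; A v6 v3\<rbrakk>
      \<Longrightarrow> False"
begin

lemma pattern_free_subset:
  assumes "W \<subseteq> V"
  shows "pattern_free W A"
proof
  show "finite W" using assms finite_verts finite_subset by blast
  show "\<not> A v v" if "v \<in> W" for v using that assms irrefl by blast
  show "A u v \<longleftrightarrow> \<not> A v u" if "u \<in> W" "v \<in> W" "u \<noteq> v" for u v
    using that assms total by blast
qed ((rule no_Delta[OF subset_trans[OF _ assms]]; assumption),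
  (rule no_T5[OF subset_trans[OF _ assms]]; assumption),
  (rule no_P7_minus[OF subset_trans[OF _ assms]]; assumption))

text \<open>Exchanging \<open>y1\<close> with \<open>y2\<close> or \<open>z1\<close> with
  \<open>z2\<close> preserves all other arcs of the pattern, so the two inner arcs may have either
  direction.\<close>

lemma no_Delta_unordered:
  assumes "{x, y1, y2, z1, z2} \<subseteq> V" "y1 \<noteq> y2" "z1 \<noteq> z2"
    and "A x y1" "A x y2" "A y1 z1" "A y1 z2" "A y2 z1" "A y2 z2" "A z1 x" "A z2 x"
  shows False
proof -
  have "A y1 y2 \<or> A y2 y1" "A z1 z2 \<or> A z2 z1"
    using assms(1-3) total[of y1 y2] total[of z1 z2] by blast+
  then show False
    using assms no_Delta[of x y1 y2 z1 z2] no_Delta[of x y2 y1 z1 z2]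
      no_Delta[of x y1 y2 z2 z1] no_Delta[of x y2 y1 z2 z1] by auto
qed

section \<open>A vertex of small in-degree\<close>

text \<open>Take \<open>v\<close> of maximal in-degree within \<open>D\<close> and an arc from \<open>v\<close> to \<open>w\<close>: some in-neighbour of
  \<open>v\<close> is not one of \<open>w\<close>.\<close>

lemma cyclic_triangle:
  assumes "D \<subseteq> V" "D \<noteq> {}" and step: "\<And>v. v \<in> D \<Longrightarrow> \<exists>w\<in>D. A v w"
  obtains a b c where "a \<in> D" "b \<in> D" "c \<in> D" "A a b" "A b c" "A c a"
proof -
  have "finite D" using assms(1) finite_verts finite_subset by blast
  define ind where "ind v = {u \<in> D. A u v}" for v
  have fin: "finite (ind v)" for v using \<open>finite D\<close> by (simp add: ind_def)
  have "Max ((\<lambda>v. card (ind v)) ` D) \<in> (\<lambda>v. card (ind v)) ` D"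
    using \<open>finite D\<close> \<open>D \<noteq> {}\<close> by (intro Max_in) auto
  then obtain v where v: "v \<in> D" and "card (ind v) = Max ((\<lambda>v. card (ind v)) ` D)" by auto
  then have max: "card (ind w) \<le> card (ind v)" if "w \<in> D" for w
    using \<open>finite D\<close> that by simp
  obtain w where w: "w \<in> D" "A v w" using step[OF v] by blast
  \<comment> \<open>As \<open>v\<close> is not in \<open>ind v\<close>, this inclusion would give
    \<open>w\<close> a larger in-degree within \<open>D\<close> than the maximum.\<close>
  have "\<not> insert v (ind v) \<subseteq> ind w"
  proof
    assume "insert v (ind v) \<subseteq> ind w"
    then have "card (insert v (ind v)) \<le> card (ind w)" using fin card_mono by blast
    moreover have "v \<notin> ind v" using irrefl v assms(1) by (auto simp: ind_def)
    ultimately show False using max[OF w(1)] fin by simp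
  qed
  then obtain u where "u \<in> D" "A u v" "\<not> A u w"
    using v w by (auto simp: ind_def)
  moreover from this have "u \<noteq> w" using v w total assms(1) irrefl by blast
  ultimately have "A w u" using total w assms(1) by blast
  then show thesis using that[of u v w] \<open>u \<in> D\<close> \<open>A u v\<close> v w by blast
qed

text \<open>Every in-neighbour of the vertex of least rank comes later and so forms a backedge with
  it; a sparse ranking allows only one.\<close>

lemma sparse_ranking_first:
  assumes "sparse_ranking W A r" "W \<subseteq> V" "W \<noteq> {}"
  obtains w where "w \<in> W" "\<And>u v. \<lbrakk>u \<in> W; v \<in> W; A u w; A v w\<rbrakk> \<Longrightarrow> u = v"
proof -
  have "finite W" using assms(2) finite_verts finite_subset by blast
  then have "Min (r ` W) \<in> r ` W" using assms(3) by (intro Min_in) auto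
  then obtain w where w: "w \<in> W" "r w = Min (r ` W)" by auto
  have "r w < r u" if "u \<in> W" "A u w" for u
  proof -
    have "u \<noteq> w" using irrefl that assms(2) w by blast
    moreover have "r w \<le> r u" using w \<open>finite W\<close> that by simp
    ultimately show ?thesis
      using sparse_ranking_inj[OF assms(1) that(1) w(1)] by fastforce
  qed
  then show thesis
    using that[OF w(1)] sparse_ranking_later[OF assms(1) w(1)] by blast
qed

text \<open>Let \<open>b0\<close>, \<open>b1\<close>, \<open>b2\<close> be the further in-neighbours
  of a cyclic triangle of vertices of in-degree two. If all three coincide, \<Delta>(1,2,2) appears;
  if exactly two do, \<Delta>(1,2,2) or \<open>T5\<close>; if they are distinct, \<Delta>(1,2,2) or
  \<open>P7_minus\<close>.\<close>

lemma ex_in_degree_le_1: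
  assumes "V \<noteq> {}" and sp: "\<And>y. y \<in> V \<Longrightarrow> \<exists>r. sparse_ranking (V - {y}) A r"
  shows "\<exists>x\<in>V. \<forall>u\<in>V. \<forall>v\<in>V. A u x \<and> A v x \<longrightarrow> u = v"
proof (rule ccontr)
  assume "\<not> ?thesis"
  then have two: "\<exists>u\<in>V. \<exists>v\<in>V. u \<noteq> v \<and> A u x \<and> A v x" if "x \<in> V" for x
    using that by blast
  have irr: "A u v \<Longrightarrow> u \<in> V \<Longrightarrow> u \<noteq> v" for u v using irrefl by blast
  have asym: "A u v \<Longrightarrow> u \<in> V \<Longrightarrow> v \<in> V \<Longrightarrow> \<not> A v u" for u v
    using irrefl total by metis
  txt \<open>The witness is the first vertex in a ranking of \<^term>\<open>V - {y}\<close>.\<close>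
  have key: "\<exists>w\<in>V. A y w \<and> (\<exists>p\<in>V. p \<noteq> y \<and> A p w \<and> (\<forall>u\<in>V. A u w \<longrightarrow> u = y \<or> u = p))"
    if y: "y \<in> V" for y
  proof -
    obtain r where r: "sparse_ranking (V - {y}) A r" using sp y by blast
    have "V - {y} \<noteq> {}" using two[OF y] by blast
    then obtain w where w: "w \<in> V - {y}"
      and uniq: "\<And>u v. \<lbrakk>u \<in> V - {y}; v \<in> V - {y}; A u w; A v w\<rbrakk> \<Longrightarrow> u = v"
      using sparse_ranking_first[OF r] by blast
    obtain u v where uv: "u \<in> V" "v \<in> V" "u \<noteq> v" "A u w" "A v w" using two w by blast
    have "\<exists>p\<in>V. p \<noteq> y \<and> A p w" using uv by metis
    \<comment> \<open>At most one in-neighbour of \<open>w\<close> differs from \<open>y\<close>,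
      but \<open>w\<close> has two.\<close>
    moreover have "A y w" using uv uniq[of u v] by blast
    ultimately show ?thesis using uniq w by blast
  qed
  \<comment> \<open>In-degree at most two, hence exactly two by \<open>two\<close>. By
    \<open>key\<close> every vertex has an out-neighbour in \<open>D\<close>, as
    \<open>cyclic_triangle\<close> requires.\<close>
  define D where "D = {w \<in> V. \<exists>p\<in>V. \<exists>q\<in>V. \<forall>u\<in>V. A u w \<longrightarrow> u = p \<or> u = q}"
  have toD: "\<exists>w\<in>D. A y w" if "y \<in> V" for y
    using key[OF that] that unfolding D_def by blast
  have "D \<subseteq> V" by (auto simp: D_def)
  moreover have "D \<noteq> {}" using assms(1) toD by blast
  ultimately obtain a0 a1 a2 where aD: "a0 \<in> D" "a1 \<in> D" "a2 \<in> D" and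
    a: "A a0 a1" "A a1 a2" "A a2 a0"
    using cyclic_triangle[of D] toD by blast
  have aV: "a0 \<in> V" "a1 \<in> V" "a2 \<in> V" using aD by (auto simp: D_def)
  have other: "\<exists>b\<in>V. A b w \<and> b \<noteq> p \<and> (\<forall>u\<in>V. A u w \<longrightarrow> u = p \<or> u = b)" if "w \<in> D" "p \<in> V" "A p w" for p w
    using that two[of w] unfolding D_def by blast
  obtain b0 where b0: "b0 \<in> V" "A b0 a0" "b0 \<noteq> a2" "\<And>u. u \<in> V \<Longrightarrow> A u a0 \<Longrightarrow> u = a2 \<or> u = b0"
    using other[OF aD(1) aV(3) a(3)] by blast
  obtain b1 where b1: "b1 \<in> V" "A b1 a1" "b1 \<noteq> a0" "\<And>u. u \<in> V \<Longrightarrow> A u a1 \<Longrightarrow> u = a0 \<or> u = b1"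
    using other[OF aD(2) aV(1) a(1)] by blast
  obtain b2 where b2: "b2 \<in> V" "A b2 a2" "b2 \<noteq> a1" "\<And>u. u \<in> V \<Longrightarrow> A u a2 \<Longrightarrow> u = a1 \<or> u = b2"
    using other[OF aD(3) aV(2) a(2)] by blast
  \<comment> \<open>Two triangle vertices share the in-neighbour \<open>b\<close>. The in-neighbours
    being known, all arcs except that between \<open>b\<close> and \<open>c\<close> are determined;
    its direction decides between \<open>T5\<close> and \<Delta>(1,2,2). The labels are generic
    because three rotations are needed.\<close>
  have coincide: False
    if V: "c0 \<in> V" "c1 \<in> V" "c2 \<in> V" "b \<in> V" "c \<in> V"
      and c: "A c0 c1" "A c1 c2" "A c2 c0"
      and b: "A b c0" "A b c1" "A c c2" "b \<noteq> c" "b \<noteq> c2" "c \<noteq> c0" "c \<noteq> c1"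
      and i0: "\<And>u. u \<in> V \<Longrightarrow> A u c0 \<Longrightarrow> u = c2 \<or> u = b"
      and i1: "\<And>u. u \<in> V \<Longrightarrow> A u c1 \<Longrightarrow> u = c0 \<or> u = b"
      and i2: "\<And>u. u \<in> V \<Longrightarrow> A u c2 \<Longrightarrow> u = c1 \<or> u = c"
    for c0 c1 c2 b c
  proof -
    have d: "c0 \<noteq> c1" "c1 \<noteq> c2" "c2 \<noteq> c0" "b \<noteq> c0" "b \<noteq> c1" "c \<noteq> c2"
      using irr V c b by blast+
    have f: "A c2 b" "A c0 c" "A c1 c"
      using V b d i0[of c] i1[of c] i2[of b] total by metis+
    show False
    proof (cases "A c b")
      case True
      then show False using no_T5[of c0 c1 c c2 b] V c b f by simp
    next
      case False
      then have "A b c" using total V b by blast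
      then show False using no_Delta[of c2 b c0 c1 c] V b c f by simp
    qed
  qed
  have d: "a0 \<noteq> a1" "a1 \<noteq> a2" "a2 \<noteq> a0" "b0 \<noteq> a0" "b1 \<noteq> a1" "b2 \<noteq> a2" "b0 \<noteq> a1" "b1 \<noteq> a2" "b2 \<noteq> a0"
    using irr asym aV a b0(1,2) b1(1,2) b2(1,2) by blast+
  consider "b0 = b1" "b1 = b2" | "b0 = b1" "b1 \<noteq> b2" | "b1 = b2" "b2 \<noteq> b0" | "b2 = b0" "b0 \<noteq> b1"
    | "b0 \<noteq> b1" "b1 \<noteq> b2" "b2 \<noteq> b0" by blast
  then show False
  proof cases
    case 1
    \<comment> \<open>These serve as \<open>z1\<close>, \<open>z2\<close>, with \<open>b0\<close> as
      \<open>x\<close> and \<open>a0\<close>, \<open>a1\<close> as \<open>y1\<close>,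
      \<open>y2\<close>: an in-neighbour of \<open>b0\<close> is none of the in-neighbours of
      \<open>a0\<close> and \<open>a1\<close>, so both send an arc to it.\<close>
    obtain r s where rs: "r \<in> V" "s \<in> V" "r \<noteq> s" "A r b0" "A s b0" using two b0(1) by blast
    have "t \<notin> {a0, a1, a2, b0}" if "t \<in> V" "A t b0" for t
      using that asym irr aV b0(1,2) b1(2) b2(2) 1 by blast
    then have "A a0 t \<and> A a1 t" if "t \<in> V" "A t b0" for t
      using that b0(4)[of t] b1(4)[of t] 1 total aV by (metis insertCI)
    then show False
      using no_Delta_unordered[of b0 a0 a1 r s] rs aV b0(1,2) b1(2) 1 d by simp
  next
    case 2
    then show False using coincide[of a0 a1 a2 b0 b2] aV b0 b1 b2 a d by blast
  next
    case 3
    then show False using coincide[of a1 a2 a0 b1 b0] aV b0 b1 b2 a d by blast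
  next
    case 4
    then show False using coincide[of a2 a0 a1 b2 b1] aV b0 b1 b2 a d by blast
  next
    case 5
    have e: "A a0 b1" "A a0 b2" "A a1 b0" "A a1 b2" "A a2 b0" "A a2 b1"
      using 5 d b0 b1 b2 total aV by metis+
    note facts = e a b0(2) b1(2) b2(2) aV b0(1) b1(1) b2(1)
    \<comment> \<open>Any one of the arcs \<open>A b0 b1\<close>, \<open>A b1 b2\<close>,
      \<open>A b2 b0\<close> completes a copy of \<Delta>(1,2,2); if all three are reversed, the six
      vertices form \<open>P7_minus\<close>.\<close>
    have "A b0 b1 \<or> A b1 b0" "A b1 b2 \<or> A b2 b1" "A b2 b0 \<or> A b0 b2"
      using 5 b0(1) b1(1) b2(1) total by blast+
    then show False
      using facts no_P7_minus[of a0 a1 b2 a2 b1 b0] no_Delta[of a0 a1 b2 a2 b0]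
        no_Delta[of a2 a0 b1 a1 b2] no_Delta[of a1 a2 b0 a0 b1]
      by (elim disjE) simp_all
  qed
qed

section \<open>Inserting a vertex of small in-degree\<close>

text \<open>Either rotation of \<open>j\<close>, \<open>m\<close>, \<open>k\<close> removes the
  backedge between \<open>j\<close> and \<open>k\<close>, freeing \<open>k\<close> for its backedge
  with \<open>x\<close>, and creates one at \<open>m\<close>. Moving \<open>j\<close> behind
  \<open>k\<close> needs \<open>m\<close> to have no later back-neighbour; if it has one,
  \<open>m\<close> has no earlier one and \<open>k\<close> can move before \<open>j\<close>.\<close>

lemma sparse_ranking_insert:
  assumes x: "x \<in> V" and x_in: "\<And>u v. \<lbrakk>u \<in> V; v \<in> V; A u x; A v x\<rbrakk> \<Longrightarrow> u = v"
    and "sparse_ranking (V - {x}) A r0"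
  shows "\<exists>r. sparse_ranking V A r"
proof -
  define W where "W = V - {x}"
  have WV: "W \<subseteq> V" and V: "V = insert x W" and xW: "x \<notin> W" using x by (auto simp: W_def)
  interpret W: pattern_free W A using pattern_free_subset[OF WV] .
  obtain r where r: "sparse_ranking W A r"
    and gap: "\<And>u v. \<lbrakk>u \<in> W; v \<in> W; r u < r v; A v u\<rbrakk> \<Longrightarrow> \<exists>w\<in>W. r u < r w \<and> r w < r v"
    using W.sparse_ranking_no_consecutive assms(3) unfolding W_def by blast
  note later = sparse_ranking_later[OF r] and earlier = sparse_ranking_earlier[OF r]
  have inj: "r u = r v \<longleftrightarrow> u = v" if "u \<in> W" "v \<in> W" for u v
    using sparse_ranking_inj[OF r that] by blast
  \<comment> \<open>The rank of \<open>x\<close>, to be compared with doubled ranks. It lies even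
    below \<open>2 * r j - 1\<close>, the place given to \<open>k\<close> in the last case.\<close>
  define L where "L = 2 * Min (r ` W) - 2"
  have L: "L < 2 * r w - 1" if "w \<in> W" for w
  proof -
    have "Min (r ` W) \<le> r w" using W.finite_verts that by simp
    then show ?thesis by (simp add: L_def)
  qed
  have loop: "\<not> A v v" if "v \<in> V" for v using irrefl that .
  show ?thesis
  proof (cases "\<exists>k\<in>W. \<exists>j\<in>W. A k x \<and> A k j \<and> r j < r k")
    case False
    define r' where "r' = (\<lambda>v. if v = x then L else 2 * r v)"
    have "sparse_ranking V A r'"
    proof (rule sparse_rankingI[where B = "\<lambda>p q. (p \<in> W \<and> q \<in> W \<and> r p < r q \<and> A q p) \<or>
        (p = x \<and> q \<in> W \<and> A q x)"])
      show "inj_on r' V"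
      proof (rule inj_onI)
        show "u = v" if "u \<in> V" "v \<in> V" "r' u = r' v" for u v
          using that inj L[of u] L[of v] by (auto simp: r'_def V split: if_splits)
      qed
      show "(u \<in> W \<and> v \<in> W \<and> r u < r v \<and> A v u) \<or> (u = x \<and> v \<in> W \<and> A v x)"
        if "u \<in> V" "v \<in> V" "r' u < r' v" "A v u" for u v
        using that L[of u] loop[of x] by (auto simp: r'_def V split: if_splits)
      show "v = w" if "(u \<in> W \<and> v \<in> W \<and> r u < r v \<and> A v u) \<or> (u = x \<and> v \<in> W \<and> A v x)"
        "(u \<in> W \<and> w \<in> W \<and> r u < r w \<and> A w u) \<or> (u = x \<and> w \<in> W \<and> A w x)" for u v w
        using that later[of u v w] x_in[of v w] WV xW by blast
      show "v = w" if "(v \<in> W \<and> u \<in> W \<and> r v < r u \<and> A u v) \<or> (v = x \<and> u \<in> W \<and> A u x)"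
        "(w \<in> W \<and> u \<in> W \<and> r w < r u \<and> A u w) \<or> (w = x \<and> u \<in> W \<and> A u x)" for u v w
        using that earlier[of u v w] False by blast
    qed
    then show ?thesis by blast
  next
    case True
    then obtain j k where jk: "j \<in> W" "k \<in> W" "A k x" "A k j" "r j < r k" by blast
    have xk: "q = k" if "q \<in> W" "A q x" for q using x_in that jk WV by blast
    have x_out: "A x q" if "q \<in> W" "q \<noteq> k" for q
      using xk[OF that(1)] that total[of x q] x xW WV by blast
    have arc: "A p q \<or> A q p" if "p \<in> W" "q \<in> W" "p \<noteq> q" for p q using W.total that by blast
    have asym: "\<not> A q p" if "p \<in> W" "q \<in> W" "A p q" for p q using W.total W.irrefl that by metis
    \<comment> \<open>The backedge between \<open>j\<close> and \<open>k\<close> is not consecutive,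
      by the choice of \<open>r\<close>.\<close>
    obtain m where m: "m \<in> W" "r j < r m" "r m < r k" using gap jk by blast
    \<comment> \<open>The only later back-neighbour of \<open>j\<close> is \<open>k\<close>, and the
      only earlier one of \<open>k\<close> is \<open>j\<close>.\<close>
    have between: "A j w" "A w k" if "w \<in> W" "r j < r w" "r w < r k" for w
      using that jk later[of j w k] earlier[of k w j] arc[of j w] arc[of w k] by force+
    \<comment> \<open>A second such vertex gives \<Delta>(1,2,2) with \<open>k\<close> in the role
      of its first vertex, then \<open>x\<close>, \<open>j\<close>, then \<open>w\<close>,
      \<open>m\<close>. The rank of \<open>w\<close> is unrestricted, so this also yields
      \<open>j_earlier\<close> and \<open>k_later\<close>.\<close>
    have only_m: "w = m" if "w \<in> W" "A j w" "A w k" for w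
    proof (rule ccontr)
      assume "w \<noteq> m"
      moreover have "A x w" "A x m" "A x j" "A j m" "A m k" "w \<noteq> k" "j \<noteq> x"
        using that jk m between[of m] x_out W.irrefl xW by auto
      ultimately show False
        using no_Delta_unordered[of k x j w m] that jk m WV x by blast
    qed
    have between_m: "w = m" if "w \<in> W" "r j < r w" "r w < r k" for w
      using only_m between that by blast
    have j_earlier: "\<not> A j q" if "q \<in> W" "r q < r j" for q
    proof
      assume "A j q"
      then have "A q k" using that jk earlier[of k q j] arc[of q k] by force
      then show False using only_m[of q] \<open>A j q\<close> that m by simp
    qed
    have k_later: "\<not> A q k" if "q \<in> W" "r k < r q" for q
    proof
      assume "A q k"
      then have "A j q" using that jk later[of j q k] arc[of q j] by force
      then show False using only_m[of q] \<open>A q k\<close> that m by simp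
    qed
    have jm: "A j m" and mk: "A m k" using between m by blast+
    show ?thesis
    proof (cases "\<exists>l\<in>W. r m < r l \<and> A l m")
      case no_l: False
      txt \<open>Doubling the ranks makes room for \<^term>\<open>j\<close> just after \<^term>\<open>k\<close>.\<close>
      define r' where "r' = (\<lambda>v. if v = x then L else if v = j then 2 * r k + 1 else 2 * r v)"
      have r'_inj: "inj_on r' V"
      proof (rule inj_onI)
        show "u = v" if "u \<in> V" "v \<in> V" "r' u = r' v" for u v
          using that inj L[of u] L[of v] L[of j] L[of k] jk
          by (auto simp: r'_def V split: if_splits) presburger+
      qed
      \<comment> \<open>The exclusions ensure that no old backedge clashes with
        \<open>(x, k)\<close> or \<open>(m, j)\<close>, the new pairs.\<close>
      have B: "(u \<in> W \<and> v \<in> W \<and> r u < r v \<and> A v u \<and> u \<noteq> j \<and> u \<noteq> m \<and> v \<noteq> k \<and> v \<noteq> j) \<or>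
            (u = x \<and> v = k) \<or> (u = m \<and> v = j)"
        if uv: "u \<in> V" "v \<in> V" "r' u < r' v" "A v u" for u v
      proof (cases "u = x")
        case True
        then show ?thesis using uv xk[of v] loop[of x] V by blast
      next
        case False
        then have uW: "u \<in> W" using uv V by blast
        have vW: "v \<in> W" using uv L[OF uW] L[OF jk(2)] False by (auto simp: r'_def V split: if_splits)
        then have "v \<noteq> x" using xW by blast
        have "u \<noteq> v" using uv by blast
        show ?thesis
        proof (cases "v = j")
          case True
          then have "r u \<le> r k" using uv False \<open>u \<noteq> v\<close> jk \<open>v \<noteq> x\<close> by (auto simp: r'_def split: if_splits)
          moreover have "u \<noteq> k" using uv True asym jk by blast
          moreover have "\<not> r u \<le> r j"
            using j_earlier[OF uW] inj[OF uW jk(1)] uv True \<open>u \<noteq> v\<close> by force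
          ultimately have "u = m" using between_m[OF uW] inj[OF uW jk(2)] by force
          then show ?thesis using True by blast
        next
          case v: False
          have "u \<noteq> j"
          proof
            assume "u = j"
            then have "r k < r v" using uv v \<open>v \<noteq> x\<close> False by (auto simp: r'_def split: if_splits)
            then have "v = k" using later[OF jk(1) vW jk(2)] uv \<open>u = j\<close> jk by force
            then show False using \<open>r k < r v\<close> by simp
          qed
          then have "r u < r v" using uv v \<open>v \<noteq> x\<close> False by (auto simp: r'_def split: if_splits)
          moreover have "u \<noteq> m" using no_l vW \<open>r u < r v\<close> uv by blast
          moreover have "v \<noteq> k"
            using earlier[OF jk(2) uW jk(1)] jk uv \<open>r u < r v\<close> \<open>u \<noteq> j\<close> by blast
          ultimately show ?thesis using uv uW vW v \<open>u \<noteq> j\<close> by blast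
        qed
      qed
      have "sparse_ranking V A r'"
      proof (rule sparse_rankingI[OF r'_inj B])
        show "v = w" if "(u \<in> W \<and> v \<in> W \<and> r u < r v \<and> A v u \<and> u \<noteq> j \<and> u \<noteq> m \<and> v \<noteq> k \<and> v \<noteq> j) \<or>
            (u = x \<and> v = k) \<or> (u = m \<and> v = j)"
          "(u \<in> W \<and> w \<in> W \<and> r u < r w \<and> A w u \<and> u \<noteq> j \<and> u \<noteq> m \<and> w \<noteq> k \<and> w \<noteq> j) \<or>
            (u = x \<and> w = k) \<or> (u = m \<and> w = j)" for u v w
          using that later[of u v w] xW m(1) by blast
        show "v = w" if "(v \<in> W \<and> u \<in> W \<and> r v < r u \<and> A u v \<and> v \<noteq> j \<and> v \<noteq> m \<and> u \<noteq> k \<and> u \<noteq> j) \<or>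
            (v = x \<and> u = k) \<or> (v = m \<and> u = j)"
          "(w \<in> W \<and> u \<in> W \<and> r w < r u \<and> A u w \<and> w \<noteq> j \<and> w \<noteq> m \<and> u \<noteq> k \<and> u \<noteq> j) \<or>
            (w = x \<and> u = k) \<or> (w = m \<and> u = j)" for u v w
          using that earlier[of u v w] jk by blast
      qed
      then show ?thesis by blast
    next
      case True
      then obtain l where l: "l \<in> W" "r m < r l" "A l m" by blast
      have "\<not> r l < r k" using between_m[of l] l m by force
      moreover have "l \<noteq> k" using l mk asym jk m by blast
      ultimately have kl: "r k < r l" using inj[OF jk(2) l(1)] by simp
      have jl: "A j l" using later[OF jk(1) l(1) jk(2)] kl jk arc[OF jk(1) l(1)] by force
      have "A k l" using k_later[OF l(1) kl] arc[OF jk(2) l(1)] kl by blast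
      \<comment> \<open>Otherwise \<open>m\<close>, then \<open>i\<close>, \<open>k\<close>, then
        \<open>j\<close>, \<open>l\<close> form \<Delta>(1,2,2).\<close>
      have m_earlier: "\<not> A m i" if i: "i \<in> W" "r i < r m" for i
      proof
        assume "A m i"
        have "i \<noteq> j" using \<open>A m i\<close> jm asym jk m by blast
        moreover have "\<not> r j < r i" using between_m[OF i(1)] i m by force
        ultimately have ij: "r i < r j" using inj[OF i(1) jk(1)] by simp
        have "A i j" using j_earlier[OF i(1) ij] arc[OF i(1) jk(1)] \<open>i \<noteq> j\<close> by blast
        moreover have "A i k" using earlier[OF jk(2) i(1) jk(1)] ij jk arc[OF i(1) jk(2)] by force
        moreover have "A i l"
          using later[OF i(1) m(1) l(1)] i l \<open>A m i\<close> arc[OF i(1) l(1)] by force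
        ultimately show False
          using W.no_Delta[of m i k j l] \<open>A m i\<close> mk jm l jl \<open>A k l\<close> jk m i by simp
      qed
      \<comment> \<open>The free odd value just below the doubled rank of \<open>j\<close> receives
        \<open>k\<close>.\<close>
      define r' where "r' = (\<lambda>v. if v = x then L else if v = k then 2 * r j - 1 else 2 * r v)"
      have r'_inj: "inj_on r' V"
      proof (rule inj_onI)
        show "u = v" if "u \<in> V" "v \<in> V" "r' u = r' v" for u v
          using that inj L[of u] L[of v] L[of j] jk
          by (auto simp: r'_def V split: if_splits) presburger+
      qed
      have B: "(u \<in> W \<and> v \<in> W \<and> r u < r v \<and> A v u \<and> u \<noteq> k \<and> v \<noteq> k \<and> v \<noteq> m) \<or>
            (u = x \<and> v = k) \<or> (u = k \<and> v = m)"
        if uv: "u \<in> V" "v \<in> V" "r' u < r' v" "A v u" for u v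
      proof (cases "u = x")
        case True
        then show ?thesis using uv xk[of v] loop[of x] V by blast
      next
        case False
        then have uW: "u \<in> W" using uv V by blast
        have vW: "v \<in> W" using uv L[OF uW] L[OF jk(1)] False by (auto simp: r'_def V split: if_splits)
        then have "v \<noteq> x" using xW by blast
        have "u \<noteq> v" using uv by blast
        show ?thesis
        proof (cases "u = k")
          case True
          then have "r j \<le> r v" using uv False \<open>u \<noteq> v\<close> \<open>v \<noteq> x\<close> by (auto simp: r'_def split: if_splits)
          moreover have "v \<noteq> j" using uv True asym jk by blast
          moreover have "\<not> r k < r v" using k_later[OF vW] uv True by blast
          ultimately have "v = m"
            using between_m[OF vW] inj[OF jk(1) vW] inj[OF vW jk(2)] True \<open>u \<noteq> v\<close> by force
          then show ?thesis using True by blast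
        next
          case u: False
          have "v \<noteq> k"
          proof
            assume "v = k"
            then have "r u < r j" using uv u False \<open>v \<noteq> x\<close> by (auto simp: r'_def split: if_splits)
            then have "u = j" using earlier[OF jk(2) uW jk(1)] uv \<open>v = k\<close> jk by force
            then show False using \<open>r u < r j\<close> by simp
          qed
          then have "r u < r v" using uv u \<open>v \<noteq> x\<close> False by (auto simp: r'_def split: if_splits)
          then show ?thesis using uv uW vW u \<open>v \<noteq> k\<close> m_earlier by blast
        qed
      qed
      have "sparse_ranking V A r'"
      proof (rule sparse_rankingI[OF r'_inj B])
        show "v = w" if "(u \<in> W \<and> v \<in> W \<and> r u < r v \<and> A v u \<and> u \<noteq> k \<and> v \<noteq> k \<and> v \<noteq> m) \<or>
            (u = x \<and> v = k) \<or> (u = k \<and> v = m)"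
          "(u \<in> W \<and> w \<in> W \<and> r u < r w \<and> A w u \<and> u \<noteq> k \<and> w \<noteq> k \<and> w \<noteq> m) \<or>
            (u = x \<and> w = k) \<or> (u = k \<and> w = m)" for u v w
          using that later[of u v w] xW jk(2) by blast
        show "v = w" if "(v \<in> W \<and> u \<in> W \<and> r v < r u \<and> A u v \<and> v \<noteq> k \<and> u \<noteq> k \<and> u \<noteq> m) \<or>
            (v = x \<and> u = k) \<or> (v = k \<and> u = m)"
          "(w \<in> W \<and> u \<in> W \<and> r w < r u \<and> A u w \<and> w \<noteq> k \<and> u \<noteq> k \<and> u \<noteq> m) \<or>
            (w = x \<and> u = k) \<or> (w = k \<and> u = m)" for u v w
          using that earlier[of u v w] m jk by blast
      qed
      then show ?thesis by blast
    qed
  qed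
qed

end

text \<open>The induction hypothesis serves twice: for all sets \<open>V - {y}\<close> to find a
  vertex of small in-degree, then for that vertex to reinsert it.\<close>

lemma pattern_free_sparse_ranking: "pattern_free V A \<Longrightarrow> \<exists>r. sparse_ranking V A r"
proof (induction "card V" arbitrary: V rule: less_induct)
  case less
  interpret pattern_free V A by (rule less.prems)
  show ?case
  proof (cases "V = {}")
    case True
    then show ?thesis by (auto intro: sparse_rankingI[where B = "\<lambda>_ _. False"])
  next
    case False
    have IH: "\<exists>r. sparse_ranking (V - {y}) A r" if "y \<in> V" for y
      using less.hyps[of "V - {y}"] pattern_free_subset[of "V - {y}"] that finite_verts
      by (simp add: card_Diff1_less del: card_Diff_insert)
    obtain x where "x \<in> V" "\<And>u v. \<lbrakk>u \<in> V; v \<in> V; A u x; A v x\<rbrakk> \<Longrightarrow> u = v"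
      using ex_in_degree_le_1[OF False IH] by blast
    then show ?thesis using sparse_ranking_insert IH by blast
  qed
qed

section \<open>Tournaments as directed graphs\<close>

text \<open>Sorting by \<open>r\<close> turns comparisons of ranks into comparisons of indices, and
  \<open>gap\<close> then rules out consecutive backedges.\<close>

lemma sparse_ranking_imp_paving_ordering:
  assumes "finite (verts T)" and sp: "sparse_ranking (verts T) (\<lambda>u v. u \<rightarrow>\<^bsub>T\<^esub> v) r"
    and gap: "\<And>u v. \<lbrakk>u \<in> verts T; v \<in> verts T; r u < r v; v \<rightarrow>\<^bsub>T\<^esub> u\<rbrakk>
      \<Longrightarrow> \<exists>w\<in>verts T. r u < r w \<and> r w < r v"
  shows "\<exists>vs. paving_ordering T vs"
proof -
  obtain xs where xs: "set xs = verts T" "distinct xs"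
    using finite_distinct_list[OF assms(1)] by blast
  define vs where "vs = sort_key r xs"
  have vs: "set vs = verts T" "distinct vs" using xs by (auto simp: vs_def)
  have V: "vs ! i \<in> verts T" if "i < length vs" for i using vs(1) that nth_mem by blast
  have mono: "r (vs ! i) < r (vs ! j)" if "i < j" "j < length vs" for i j
  proof -
    have "sorted (map r vs)" by (simp add: vs_def)
    then have "r (vs ! i) \<le> r (vs ! j)" using sorted_nth_mono[of "map r vs" i j] that by simp
    moreover have "vs ! i \<noteq> vs ! j" using vs(2) that by (simp add: nth_eq_iff_index_eq)
    then have "r (vs ! i) \<noteq> r (vs ! j)" using sparse_ranking_inj[OF sp V[of i] V[of j]] that by auto
    ultimately show ?thesis by simp
  qed
  have nth_less: "i < j" if "r (vs ! i) < r (vs ! j)" "i < length vs" "j < length vs" for i j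
    using mono[of j i] that by (cases i j rule: linorder_cases) auto
  have edge: "vs ! i \<rightarrow>\<^bsub>backedge_graph T vs\<^esub> vs ! j \<longleftrightarrow>
      (j < i \<and> vs ! i \<rightarrow>\<^bsub>T\<^esub> vs ! j) \<or> (i < j \<and> vs ! j \<rightarrow>\<^bsub>T\<^esub> vs ! i)"
    if "i < length vs" "j < length vs" for i j
    using that vs(2) by (auto simp: backedge_graph_def nth_eq_iff_index_eq)
  \<comment> \<open>For infinite sets \<open>card\<close> is \<open>0\<close>, so no finiteness has
    to be shown.\<close>
  have le1: "card S \<le> 1" if "\<And>v w. v \<in> S \<Longrightarrow> w \<in> S \<Longrightarrow> v = w" for S :: "'a set"
  proof (cases "finite S")
    case True
    then show ?thesis using that by (auto simp: card_le_Suc0_iff_eq)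
  qed simp
  have "paving_ordering T vs"
    unfolding paving_ordering_def vertex_ordering_def
  proof (intro conjI allI impI)
    fix i assume i: "Suc i < length vs"
    show "\<not> vs ! i \<rightarrow>\<^bsub>backedge_graph T vs\<^esub> vs ! Suc i"
    proof
      assume "vs ! i \<rightarrow>\<^bsub>backedge_graph T vs\<^esub> vs ! Suc i"
      then have "vs ! Suc i \<rightarrow>\<^bsub>T\<^esub> vs ! i" using edge i by auto
      then obtain w where "w \<in> verts T" "r (vs ! i) < r w" "r w < r (vs ! Suc i)"
        using gap V mono i by (metis Suc_lessD lessI)
      then obtain k where "k < length vs" "r (vs ! i) < r (vs ! k)" "r (vs ! k) < r (vs ! Suc i)"
        using vs(1) by (metis in_set_conv_nth)
      then show False using nth_less[of i k] nth_less[of k "Suc i"] i by simp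
    qed
  next
    fix i assume i: "i < length vs"
    show "card {vs ! s | s. s < i \<and> vs ! i \<rightarrow>\<^bsub>backedge_graph T vs\<^esub> vs ! s} \<le> 1"
    proof (rule le1, clarify)
      fix s t assume "s < i" "t < i"
        "vs ! i \<rightarrow>\<^bsub>backedge_graph T vs\<^esub> vs ! s" "vs ! i \<rightarrow>\<^bsub>backedge_graph T vs\<^esub> vs ! t"
      then show "vs ! s = vs ! t"
        using sparse_ranking_earlier[OF sp, of "vs ! i" "vs ! s" "vs ! t"] edge V mono i by simp
    qed
    show "card {vs ! t | t. i < t \<and> t < length vs \<and> vs ! i \<rightarrow>\<^bsub>backedge_graph T vs\<^esub> vs ! t} \<le> 1"
    proof (rule le1, clarify)
      fix s t assume "i < s" "s < length vs" "i < t" "t < length vs"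
        "vs ! i \<rightarrow>\<^bsub>backedge_graph T vs\<^esub> vs ! s" "vs ! i \<rightarrow>\<^bsub>backedge_graph T vs\<^esub> vs ! t"
      then show "vs ! s = vs ! t"
        using sparse_ranking_later[OF sp, of "vs ! i" "vs ! s" "vs ! t"] edge V mono i by simp
    qed
  qed (use vs in auto)
  then show ?thesis by blast
qed

section \<open>Recognising the forbidden subtournaments\<close>

lemma del_vert_with_proj_relation:
  "pre_digraph.del_vert (with_proj \<lparr> pverts = P, parcs = {(i, j). i \<in> P \<and> j \<in> P \<and> Q i j} \<rparr>) u =
    with_proj \<lparr> pverts = P - {u}, parcs = {(i, j). i \<in> P - {u} \<and> j \<in> P - {u} \<and> Q i j} \<rparr>"
  by (auto simp: pre_digraph.del_vert_def with_proj_def)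

context tournament
begin

text \<open>An arc-preserving map suffices: \<open>T\<close> has no loops, so joined vertices of
  \<open>S\<close> have distinct images, and \<open>T\<close> has one arc per pair, so arcs are also
  reflected. Hence \<open>f\<close> identifies \<open>S\<close> with the subgraph induced on its
  image.\<close>

lemma not_free_ofI:
  fixes S :: "'c pair_pre_digraph"
  assumes f: "\<And>i. i \<in> pverts S \<Longrightarrow> f i \<in> verts T"
    and wf: "parcs S \<subseteq> pverts S \<times> pverts S"
    and semi: "\<And>i j. \<lbrakk>i \<in> pverts S; j \<in> pverts S; i \<noteq> j\<rbrakk> \<Longrightarrow> (i, j) \<in> parcs S \<or> (j, i) \<in> parcs S"
    and arcs: "\<And>i j. (i, j) \<in> parcs S \<Longrightarrow> f i \<rightarrow>\<^bsub>T\<^esub> f j"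
  shows "\<not> free_of (with_proj S) T"
proof -
  have irr: "\<not> u \<rightarrow>\<^bsub>T\<^esub> u" for u using adj_not_same by blast
  have inj: "inj_on f (pverts S)"
    using semi arcs irr by (metis inj_onI)
  have arcs_iff: "f i \<rightarrow>\<^bsub>T\<^esub> f j \<longleftrightarrow> (i, j) \<in> parcs S" if "i \<in> pverts S" "j \<in> pverts S" for i j
  proof (cases "i = j")
    case True
    then show ?thesis using irr arcs by blast
  next
    case False
    then have "f i \<noteq> f j" using inj that by (auto dest: inj_onD)
    then show ?thesis using semi[OF that False] arcs exactly_one_arc f that by blast
  qed
  define g where "g = the_inv_into (pverts S) f"
  have g: "g (f i) = i" if "i \<in> pverts S" for i
    unfolding g_def by (rule the_inv_into_f_f[OF inj that])
  define H where "H = T \<restriction> (f ` pverts S)"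
  have vH: "verts H = f ` pverts S" by (simp add: H_def)
  have H: "induced_subgraph H T"
    unfolding H_def using f by (intro induced_induce) auto
  \<comment> \<open>\<open>digraph_iso H S\<close> asks for a map from \<open>H\<close> to
    \<open>S\<close>, hence the inverse \<open>g\<close>. Arcs go to pairs of labels, injectively
    because \<open>T\<close> has no parallel arcs.\<close>
  define h where "h = \<lparr>iso_verts = g, iso_arcs = (\<lambda>e. (g (tail T e), g (head T e))),
    iso_head = snd, iso_tail = fst\<rparr>"
  have aH: "arcs H = {e \<in> arcs T. tail T e \<in> f ` pverts S \<and> head T e \<in> f ` pverts S}"
    by (simp add: H_def)
  have tH: "tail H = tail T" "head H = head T" by (simp_all add: H_def)
  have "inj_on (\<lambda>e. (g (tail T e), g (head T e))) (arcs H)"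
  proof (rule inj_onI)
    fix e e' assume e: "e \<in> arcs H" "e' \<in> arcs H"
      "(g (tail T e), g (head T e)) = (g (tail T e'), g (head T e'))"
    then have "tail T e = tail T e'" "head T e = head T e'" using g by (auto simp: aH)
    then show "e = e'" using e no_multi_arcs by (auto simp: aH arc_to_ends_def)
  qed
  moreover have "inj_on g (verts H)" using g by (auto simp: vH inj_on_def)
  moreover have "wf_digraph H" using H by (auto simp: induced_subgraph_def subgraph_def)
  ultimately have hom: "pre_digraph.digraph_isomorphism H h"
    by (simp add: pre_digraph.digraph_isomorphism_def h_def tH)
  have "parcs S = (\<lambda>e. (g (tail T e), g (head T e))) ` arcs H"
  proof (intro set_eqI iffI)
    fix p assume p: "p \<in> parcs S"
    obtain i j where ij: "p = (i, j)" by fastforce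
    then have "i \<in> pverts S" "j \<in> pverts S" using p wf by auto
    moreover obtain e where "e \<in> arcs T" "tail T e = f i" "head T e = f j"
      using arcs[of i j] p ij by (auto simp: arcs_ends_conv)
    ultimately have "e \<in> arcs H" "p = (g (tail T e), g (head T e))" using ij g by (auto simp: aH)
    then show "p \<in> (\<lambda>e. (g (tail T e), g (head T e))) ` arcs H" by blast
  next
    fix p assume "p \<in> (\<lambda>e. (g (tail T e), g (head T e))) ` arcs H"
    then obtain e i j where e: "e \<in> arcs T" "tail T e = f i" "head T e = f j" and
      ij: "i \<in> pverts S" "j \<in> pverts S" "p = (g (f i), g (f j))" by (auto simp: aH)
    then have "f i \<rightarrow>\<^bsub>T\<^esub> f j" using in_arcs_imp_in_arcs_ends[OF e(1)] by simp
    then show "p \<in> parcs S" using arcs_iff ij g by simp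
  qed
  then have "with_proj S = app_iso h H"
    using g by (simp add: app_iso_def h_def vH with_proj_def image_image)
  then show ?thesis using H hom unfolding free_of_def digraph_iso_def by blast
qed

lemma not_free_of_relationI:
  assumes "\<forall>i\<in>P. f i \<in> verts T" "\<forall>i\<in>P. \<forall>j\<in>P. Q i j \<longrightarrow> f i \<rightarrow>\<^bsub>T\<^esub> f j"
    and "\<forall>i\<in>P. \<forall>j\<in>P. i \<noteq> j \<longrightarrow> Q i j \<or> Q j i"
  shows "\<not> free_of (with_proj \<lparr> pverts = P, parcs = {(i, j). i \<in> P \<and> j \<in> P \<and> Q i j} \<rparr>) T"
  by (rule not_free_ofI[where f = f]) (use assms in auto)

lemma pattern_free_if_free_of:
  assumes "free_of Delta_1_2_2 T" "free_of T5 T" "free_of P7_minus T"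
  shows "pattern_free (verts T) (\<lambda>u v. u \<rightarrow>\<^bsub>T\<^esub> v)"
proof
  show "finite (verts T)" by simp
  show "\<not> v \<rightarrow>\<^bsub>T\<^esub> v" for v using adj_not_same by blast
  show "u \<rightarrow>\<^bsub>T\<^esub> v \<longleftrightarrow> \<not> v \<rightarrow>\<^bsub>T\<^esub> u" if "u \<in> verts T" "v \<in> verts T" "u \<noteq> v" for u v
    using exactly_one_arc that .
next
  fix x y1 y2 z1 z2
  assume V: "{x, y1, y2, z1, z2} \<subseteq> verts T"
    and arcs: "x \<rightarrow>\<^bsub>T\<^esub> y1" "x \<rightarrow>\<^bsub>T\<^esub> y2" "y1 \<rightarrow>\<^bsub>T\<^esub> z1" "y1 \<rightarrow>\<^bsub>T\<^esub> z2" "y2 \<rightarrow>\<^bsub>T\<^esub> z1" "y2 \<rightarrow>\<^bsub>T\<^esub> z2"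
      "z1 \<rightarrow>\<^bsub>T\<^esub> x" "z2 \<rightarrow>\<^bsub>T\<^esub> x" "y1 \<rightarrow>\<^bsub>T\<^esub> y2" "z1 \<rightarrow>\<^bsub>T\<^esub> z2"
  define f :: "nat \<Rightarrow> 'a" where "f i = (if i = 0 then x else if i = 1 then y1 else if i = 2 then y2
    else if i = 3 then z1 else z2)" for i
  let ?E = "{0::nat} \<times> {1, 2} \<union> {1, 2} \<times> {3, 4} \<union> {3, 4} \<times> {0} \<union> {(1, 2), (3, 4)}"
  have f: "\<forall>i\<in>{0, 1, 2, 3, 4}. f i \<in> verts T" "\<forall>e\<in>?E. f (fst e) \<rightarrow>\<^bsub>T\<^esub> f (snd e)"
    using V arcs by (simp_all add: f_def ball_Un)
  have semi: "\<forall>i\<in>{0, 1, 2, 3, 4}. \<forall>j\<in>{0, 1, 2, 3, 4}. i \<noteq> j \<longrightarrow> (i, j) \<in> ?E \<or> (j, i) \<in> ?E"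
    by simp
  have "\<not> free_of Delta_1_2_2 T"
    unfolding Delta_1_2_2_def
  proof (rule not_free_ofI[where f = f], goal_cases)
    case (1 i)
    then show ?case unfolding pair_pre_digraph.simps by (rule f(1)[rule_format])
  next
    case 2
    show ?case by auto
  next
    case (3 i j)
    then show ?case unfolding pair_pre_digraph.simps by (rule semi[rule_format])
  next
    case (4 i j)
    then show ?case
      using f(2)[rule_format, of "(i, j)"] unfolding pair_pre_digraph.simps fst_conv snd_conv by blast
  qed
  with assms show False by blast
next
  fix v1 v2 v3 v4 v5
  assume V: "{v1, v2, v3, v4, v5} \<subseteq> verts T"
    and arcs: "v1 \<rightarrow>\<^bsub>T\<^esub> v2" "v1 \<rightarrow>\<^bsub>T\<^esub> v3" "v2 \<rightarrow>\<^bsub>T\<^esub> v3" "v2 \<rightarrow>\<^bsub>T\<^esub> v4" "v3 \<rightarrow>\<^bsub>T\<^esub> v4" "v3 \<rightarrow>\<^bsub>T\<^esub> v5"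
      "v4 \<rightarrow>\<^bsub>T\<^esub> v5" "v4 \<rightarrow>\<^bsub>T\<^esub> v1" "v5 \<rightarrow>\<^bsub>T\<^esub> v1" "v5 \<rightarrow>\<^bsub>T\<^esub> v2"
  define f :: "int \<Rightarrow> 'a" where "f i = (if i = 1 then v1 else if i = 2 then v2 else if i = 3 then v3
    else if i = 4 then v4 else v5)" for i
  have ivl: "{1..5::int} = {1, 2, 3, 4, 5}" by auto
  have f: "\<forall>i\<in>{1..5}. f i \<in> verts T"
    "\<forall>i\<in>{1..5}. \<forall>j\<in>{1..5}. (j - i) mod 5 \<in> {1, 2} \<longrightarrow> f i \<rightarrow>\<^bsub>T\<^esub> f j"
    using V arcs unfolding ivl by (simp_all add: f_def)
  have semi: "\<forall>i\<in>{1..5::int}. \<forall>j\<in>{1..5}. i \<noteq> j \<longrightarrow>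
      (j - i) mod 5 \<in> {1, 2} \<or> (i - j) mod 5 \<in> {1, 2}"
    unfolding ivl by simp
  have "\<not> free_of T5 T"
    unfolding T5_def by (rule not_free_of_relationI[OF f semi])
  with assms show False by blast
next
  fix v1 v2 v3 v4 v5 v6
  assume V: "{v1, v2, v3, v4, v5, v6} \<subseteq> verts T"
    and arcs: "v1 \<rightarrow>\<^bsub>T\<^esub> v2" "v1 \<rightarrow>\<^bsub>T\<^esub> v3" "v1 \<rightarrow>\<^bsub>T\<^esub> v5" "v2 \<rightarrow>\<^bsub>T\<^esub> v3" "v2 \<rightarrow>\<^bsub>T\<^esub> v4" "v2 \<rightarrow>\<^bsub>T\<^esub> v6"
      "v3 \<rightarrow>\<^bsub>T\<^esub> v4" "v3 \<rightarrow>\<^bsub>T\<^esub> v5" "v4 \<rightarrow>\<^bsub>T\<^esub> v5" "v4 \<rightarrow>\<^bsub>T\<^esub> v6" "v4 \<rightarrow>\<^bsub>T\<^esub> v1" "v5 \<rightarrow>\<^bsub>T\<^esub> v6"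
      "v5 \<rightarrow>\<^bsub>T\<^esub> v2" "v6 \<rightarrow>\<^bsub>T\<^esub> v1" "v6 \<rightarrow>\<^bsub>T\<^esub> v3"
  define f :: "int \<Rightarrow> 'a" where "f i = (if i = 1 then v1 else if i = 2 then v2 else if i = 3 then v3
    else if i = 4 then v4 else if i = 5 then v5 else v6)" for i
  have ivl: "{1..6::int} = {1, 2, 3, 4, 5, 6}" by auto
  have f: "\<forall>i\<in>{1..6}. f i \<in> verts T"
    "\<forall>i\<in>{1..6}. \<forall>j\<in>{1..6}. (j - i) mod 7 \<in> {1, 2, 4} \<longrightarrow> f i \<rightarrow>\<^bsub>T\<^esub> f j"
    using V arcs unfolding ivl by (simp_all add: f_def)
  have semi: "\<forall>i\<in>{1..6::int}. \<forall>j\<in>{1..6}. i \<noteq> j \<longrightarrow>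
      (j - i) mod 7 \<in> {1, 2, 4} \<or> (i - j) mod 7 \<in> {1, 2, 4}"
    unfolding ivl by simp
  \<comment> \<open>Deleting \<open>7\<close> leaves the same relation modulo \<open>7\<close> on
    the labels \<open>1\<close> to \<open>6\<close>, so the criterion used for \<open>T5\<close>
    applies again.\<close>
  have "{1..7::int} - {7} = {1..6}" by auto
  then have "P7_minus = with_proj \<lparr> pverts = {1..6},
      parcs = {(i, j). i \<in> {1..6} \<and> j \<in> {1..6} \<and> (j - i) mod 7 \<in> {1, 2, 4}} \<rparr>"
    unfolding P7_minus_def P7_def by (simp only: del_vert_with_proj_relation)
  then show False using not_free_of_relationI[OF f semi] assms by simp
qed

end

theorem theorem5p1:
  fixes T :: "('a, 'b) pre_digraph" and x :: 'a
  assumes "tournament T"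
    and "card (verts T) \<ge> 5"
    and "free_of Delta_1_2_2 T"
    and "free_of T5 T"
    and "free_of P7_minus T"
    and "x \<in> verts T"
    and "paving_tournament (pre_digraph.del_vert T x)"
    and "card {u \<in> verts T. u \<rightarrow>\<^bsub>T\<^esub> x} \<ge> 2"
    and "card {w \<in> verts T. x \<rightarrow>\<^bsub>T\<^esub> w} \<ge> 2"
  shows "paving_tournament T"
proof -
  interpret tournament T by (rule assms(1))
  interpret pattern_free "verts T" "\<lambda>u v. u \<rightarrow>\<^bsub>T\<^esub> v"
    by (rule pattern_free_if_free_of[OF assms(3-5)])
  have "\<exists>vs. paving_ordering T vs"
    using pattern_free_sparse_ranking[OF pattern_free_axioms] sparse_ranking_no_consecutive
      sparse_ranking_imp_paving_ordering[OF finite_verts] by metis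
  then show ?thesis using assms(1) by (simp add: paving_tournament_def)
qed

end
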